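(* Let $\Delta t>0$ and let $\mathbf m_h^n\in\mathbf S_h^1$ satisfy $|\mathbf m_h^n(\mathbf z)|=1$ for all $\mathbf z\in\mathcal Q$. If $\widetilde{\mathbf m}_h^{n+1}\in\mathbf S_h^1$ satisfies $$\Big(\tfrac{\widetilde{\mathbf m}_h^{n+1}-\mathbf m_h^n}{\Delta t},\mathbf v_h\Big)_h=-\big(\mathbf m_h^n\times(\mathbf m_h^n\times\widetilde\Delta_h\widetilde{\mathbf m}_h^{n+1}),\mathbf v_h\big)_h\qquad\forall\,\mathbf v_h\in\mathbf S_h^1,$$ then for every node $\mathbf z\in\mathcal Q$ $$\frac{\widetilde{\mathbf m}_h^{n+1}(\mathbf z)-\mathbf m_h^n(\mathbf z)}{\Delta t}\cdot\mathbf m_h^n(\mathbf z)=0\qquad\text{and}\qquad|\widetilde{\mathbf m}_h^{n+1}(\mathbf z)|\ge|\mathbf m_h^n(\mathbf z)|=1 .$$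
   Context: Mesh and space: $d\in\{1,2,3\}$; $\Omega\subset\mathbb R^d$ is a bounded rectangular domain (product of intervals). $\mathscr T_h$ is a mesh of $\Omega$ into Cartesian boxes generated by the tensor product of one-dimensional partitions in each coordinate direction (from a shape-regular, quasi-uniform family). $Q_1(K)$ is the space of polynomials on $K$ of degree at most $1$ in each variable, and $\mathbf S_h^1=\{\mathbf v_h\in H^1(\Omega)^3:\mathbf v_h|_K\in Q_1(K)^3\ \forall K\in\mathscr T_h\}$. $\mathcal Q_K$ is the set of vertices of $K$, $\mathcal Q$ the set of all mesh vertices (finite element nodes). Quadrature: the tensor-product two-point Gauss--Lobatto rule, with weights $\omega_{K,\mathbf z}=2^{-d}|K|$, $\mathbf z\in\mathcal Q_K$. For functions with nodal values, $(\mathbf v,\mathbf w)_h=\sum_K\sum_{\mathbf z\in\mathcal Q_K}\omega_{K,\mathbf z}\,\mathbf v(\mathbf z)\cdot\mathbf w(\mathbf z)$; for gradients, $(\nabla\mathbf v,\nabla\mathbf w)_h=\sum_K\sum_{\mathbf z\in\mathcal Q_K}\omega_{K,\mathbf z}\nabla(\mathbf v|_K)(\mathbf z)\cdot\nabla(\mathbf w|_K)(\mathbf z)$ (Frobenius product, gradients taken elementwise). The discrete Laplacian $\widetilde\Delta_h:\mathbf S_h^1\to\mathbf S_h^1$ is defined by $(\widetilde\Delta_h\mathbf v_h,\mathbf w_h)_h=-(\nabla\mathbf v_h,\nabla\mathbf w_h)_h$ for all $\mathbf w_h\in\mathbf S_h^1$. *)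

theory Defs
  imports "HOL-Analysis.Analysis"
begin

section \<open>The Sobolev space H1\<close>

fun Ck :: "nat \<Rightarrow> (real ^ 'n \<Rightarrow> real) \<Rightarrow> bool" where
  "Ck 0 f \<longleftrightarrow> continuous_on UNIV f"
| "Ck (Suc k) f \<longleftrightarrow> (\<forall>x. f differentiable (at x)) \<and>
     (\<forall>i. Ck k (\<lambda>x. frechet_derivative f (at x) (axis i 1)))"

definition test_function :: "(real ^ 'n) set \<Rightarrow> (real ^ 'n \<Rightarrow> real) \<Rightarrow> bool" where
  "test_function \<Omega> \<phi> \<longleftrightarrow> (\<forall>k. Ck k \<phi>) \<and>
     (\<exists>C. compact C \<and> C \<subseteq> \<Omega> \<and> (\<forall>x. x \<notin> C \<longrightarrow> \<phi> x = 0))"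

definition L2 :: "(real ^ 'n) set \<Rightarrow> (real ^ 'n \<Rightarrow> real) set" where
  "L2 \<Omega> = {u. u \<in> borel_measurable (lebesgue_on \<Omega>) \<and>
              integrable (lebesgue_on \<Omega>) (\<lambda>x. (u x)\<^sup>2)}"

definition weak_partial ::
  "(real ^ 'n) set \<Rightarrow> 'n \<Rightarrow> (real ^ 'n \<Rightarrow> real) \<Rightarrow> (real ^ 'n \<Rightarrow> real) \<Rightarrow> bool" where
  "weak_partial \<Omega> i u g \<longleftrightarrow> (\<forall>\<phi>. test_function \<Omega> \<phi> \<longrightarrow>
     (LINT x|lebesgue_on \<Omega>. u x * frechet_derivative \<phi> (at x) (axis i 1))
       = - (LINT x|lebesgue_on \<Omega>. g x * \<phi> x))"

definition H1 :: "(real ^ 'n) set \<Rightarrow> (real ^ 'n \<Rightarrow> real) set" where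
  "H1 \<Omega> = {u \<in> L2 \<Omega>. \<forall>i. \<exists>g \<in> L2 \<Omega>. weak_partial \<Omega> i u g}"

section \<open>Tensor-product meshes\<close>

text \<open>A mesh is given by its one-dimensional partitions: \<open>P i\<close> is the set of breakpoints in
  direction \<open>i\<close>. A cell is represented by its lower and upper corner \<open>(l, u)\<close>, standing for the
  closed box \<open>cbox l u\<close>.\<close>

definition tensor_mesh :: "real ^ 'n \<Rightarrow> real ^ 'n \<Rightarrow> ('n \<Rightarrow> real set) \<Rightarrow> bool" where
  "tensor_mesh a b P \<longleftrightarrow>
     (\<forall>i. finite (P i) \<and> a $ i \<in> P i \<and> b $ i \<in> P i \<and> P i \<subseteq> {a $ i .. b $ i})"

definition consecutive :: "real set \<Rightarrow> real \<Rightarrow> real \<Rightarrow> bool" where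
  "consecutive S s t \<longleftrightarrow> s \<in> S \<and> t \<in> S \<and> s < t \<and> {s<..<t} \<inter> S = {}"

definition cells :: "('n \<Rightarrow> real set) \<Rightarrow> ((real ^ 'n) \<times> (real ^ 'n)) set" where
  "cells P = {(l, u). \<forall>i. consecutive (P i) (l $ i) (u $ i)}"

definition vertices :: "real ^ 'n \<Rightarrow> real ^ 'n \<Rightarrow> (real ^ 'n) set" where
  "vertices l u = {z. \<forall>i. z $ i = l $ i \<or> z $ i = u $ i}"

definition nodes :: "('n \<Rightarrow> real set) \<Rightarrow> (real ^ 'n) set" where
  "nodes P = (\<Union>(l, u)\<in>cells P. vertices l u)"

text \<open>Every cell contains a ball whose diameter \<open>2 * r\<close> is at least the diameter of the cell
  divided by a constant that is uniform over the family.\<close>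

definition shape_regular :: "('n::finite \<Rightarrow> real set) set \<Rightarrow> bool" where
  "shape_regular F \<longleftrightarrow> (\<exists>\<sigma>>0. \<forall>P\<in>F. \<forall>(l, u)\<in>cells P.
     \<exists>x. \<exists>r\<ge>0. cball x r \<subseteq> cbox l u \<and> diameter (cbox l u) \<le> \<sigma> * (2 * r))"

definition quasi_uniform :: "('n::finite \<Rightarrow> real set) set \<Rightarrow> bool" where
  "quasi_uniform F \<longleftrightarrow> (\<exists>c>0. \<forall>P\<in>F. \<forall>(l, u)\<in>cells P. \<forall>(l', u')\<in>cells P.
     c * diameter (cbox l' u') \<le> diameter (cbox l u))"

section \<open>The finite element space\<close>

text \<open>The monomials of degree at most 1 in each variable are the products of coordinates
  over subsets of the index type.\<close>

definition Q1 :: "(real ^ 'n \<Rightarrow> real) set" where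
  "Q1 = {p. \<exists>c :: 'n set \<Rightarrow> real. \<forall>x. p x = (\<Sum>S\<in>UNIV. c S * (\<Prod>i\<in>S. x $ i))}"

text \<open>The polynomial representation is required pointwise on the closed cells, so an element is
  the continuous representative of its class in H1 and has well-defined nodal values. The values
  of an element outside the closure of \<open>\<Omega>\<close> are irrelevant.\<close>

definition S1 :: "(real ^ 'n) set \<Rightarrow> ('n \<Rightarrow> real set) \<Rightarrow> (real ^ 'n \<Rightarrow> real ^ 3) set" where
  "S1 \<Omega> P = {v. \<forall>k. (\<lambda>x. v x $ k) \<in> H1 \<Omega> \<and>
     (\<forall>(l, u)\<in>cells P. \<exists>p\<in>Q1. \<forall>x\<in>cbox l u. v x $ k = p x)}"

section \<open>Quadrature and the discrete Laplacian\<close>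

definition weight :: "real ^ 'n \<Rightarrow> real ^ 'n \<Rightarrow> real" where
  "weight l u = measure lebesgue (cbox l u) / 2 ^ CARD('n)"

definition ip_h :: "('n \<Rightarrow> real set) \<Rightarrow>
    (real ^ 'n \<Rightarrow> real ^ 3) \<Rightarrow> (real ^ 'n \<Rightarrow> real ^ 3) \<Rightarrow> real" where
  "ip_h P v w = (\<Sum>(l, u)\<in>cells P. \<Sum>z\<in>vertices l u. weight l u * (v z \<bullet> w z))"

text \<open>The Jacobian of the restriction of \<open>v\<close> to the cell: the derivative is taken within the
  closed cell, hence is one-sided at the vertices.\<close>

definition grad_cell :: "real ^ 'n \<Rightarrow> real ^ 'n \<Rightarrow>
    (real ^ 'n \<Rightarrow> real ^ 3) \<Rightarrow> real ^ 'n \<Rightarrow> real ^ 'n ^ 3" where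
  "grad_cell l u v z = matrix (frechet_derivative v (at z within cbox l u))"

text \<open>The inner product on \<open>real ^ 'n ^ 3\<close> is the Frobenius product.\<close>

definition grad_ip_h :: "('n \<Rightarrow> real set) \<Rightarrow>
    (real ^ 'n \<Rightarrow> real ^ 3) \<Rightarrow> (real ^ 'n \<Rightarrow> real ^ 3) \<Rightarrow> real" where
  "grad_ip_h P v w = (\<Sum>(l, u)\<in>cells P. \<Sum>z\<in>vertices l u.
     weight l u * (grad_cell l u v z \<bullet> grad_cell l u w z))"

text \<open>Choice rather than definite description, because the defining equations determine the
  result only on the closure of \<open>\<Omega>\<close>.\<close>

definition disc_laplacian :: "(real ^ 'n) set \<Rightarrow> ('n \<Rightarrow> real set) \<Rightarrow>
    (real ^ 'n \<Rightarrow> real ^ 3) \<Rightarrow> (real ^ 'n \<Rightarrow> real ^ 3)" where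
  "disc_laplacian \<Omega> P v =
     (SOME L. L \<in> S1 \<Omega> P \<and> (\<forall>w\<in>S1 \<Omega> P. ip_h P L w = - grad_ip_h P v w))"

end

theory Submission
  imports Defs
begin

text \<open>The quadrature is supported on the nodes, so testing with the nodal hat function at \<open>z\<close> times
  \<open>m z\<close> isolates a positive multiple of the discrete time derivative at \<open>z\<close> dotted with \<open>m z\<close>.
  The other side vanishes because a cross product with \<open>m z\<close> is orthogonal to \<open>m z\<close>;
  Pythagoras then gives the norm inequality. No property of the discrete Laplacian is involved; the
  real work is to show that the tensor-product hat functions lie in \<open>H1\<close>.\<close>

subsection \<open>One-dimensional hat functions\<close>

text \<open>The rising line is 0 at \<open>s\<close> and 1 at \<open>p\<close>, the falling line is
  1 at \<open>p\<close> and 0 at \<open>q\<close>. The smaller of the two, cut off at 0, is the hat;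
  this closed form yields measurability and the Lipschitz bound without splitting into
  pieces.\<close>

definition hat :: "real \<Rightarrow> real \<Rightarrow> real \<Rightarrow> real \<Rightarrow> real" where
  "hat s p q t = max 0 (min ((t - s) / (p - s)) ((q - t) / (q - p)))"

text \<open>At the kinks \<open>s\<close>, \<open>p\<close>, \<open>q\<close> the value defaults to
  0; these points only contribute null sets later.\<close>

definition hat_deriv :: "real \<Rightarrow> real \<Rightarrow> real \<Rightarrow> real \<Rightarrow> real" where
  "hat_deriv s p q t =
     (if s < t \<and> t < p then 1 / (p - s) else if p < t \<and> t < q then - 1 / (q - p) else 0)"

context
  fixes s p q :: real
  assumes sp: "s < p" and pq: "p < q"
begin

lemma hat_nonneg: "0 \<le> hat s p q t"
  by (simp add: hat_def)

lemma hat_eq_0: "t \<le> s \<or> q \<le> t \<Longrightarrow> hat s p q t = 0"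
proof -
  assume "t \<le> s \<or> q \<le> t"
  then have "(t - s) / (p - s) \<le> 0 \<or> (q - t) / (q - p) \<le> 0"
    using sp pq by (auto simp: divide_le_0_iff)
  then show ?thesis by (auto simp: hat_def)
qed

lemma hat_eq_left:
  assumes "s \<le> t" "t \<le> p"
  shows "hat s p q t = (t - s) / (p - s)"
proof -
  have "0 \<le> (t - s) / (p - s)" "(t - s) / (p - s) \<le> 1" "1 \<le> (q - t) / (q - p)"
    using assms sp pq by (auto simp: divide_simps)
  then show ?thesis by (simp add: hat_def)
qed

lemma hat_eq_right:
  assumes "p \<le> t" "t \<le> q"
  shows "hat s p q t = (q - t) / (q - p)"
proof -
  have "0 \<le> (q - t) / (q - p)" "(q - t) / (q - p) \<le> 1" "1 \<le> (t - s) / (p - s)"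
    using assms sp pq by (auto simp: divide_simps)
  then show ?thesis by (simp add: hat_def)
qed

lemma hat_le_1: "hat s p q t \<le> 1"
proof -
  consider "t \<le> s \<or> q \<le> t" | "s \<le> t" "t \<le> p" | "p \<le> t" "t \<le> q" by linarith
  then show ?thesis
    using sp pq by cases (auto simp: hat_eq_0 hat_eq_left hat_eq_right)
qed

text \<open>Clamping by \<open>max 0 (min _ _)\<close> changes by at most the sum of the changes of
  both arguments. The resulting constant is the sum of the two slopes, not the sharp
  maximum.\<close>

lemma hat_lipschitz:
  "\<bar>hat s p q x - hat s p q y\<bar> \<le> (1 / (p - s) + 1 / (q - p)) * \<bar>x - y\<bar>"
proof -
  have minmax: "\<bar>max 0 (min a b) - max 0 (min c d)\<bar> \<le> \<bar>a - c\<bar> + \<bar>b - d\<bar>" for a b c d :: real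
    by (auto simp: max_def min_def)
  have "\<bar>(x - s) / (p - s) - (y - s) / (p - s)\<bar> = 1 / (p - s) * \<bar>x - y\<bar>"
    using sp by (simp add: diff_divide_distrib[symmetric])
  moreover have "\<bar>(q - x) / (q - p) - (q - y) / (q - p)\<bar> = 1 / (q - p) * \<bar>x - y\<bar>"
    using pq by (simp add: diff_divide_distrib[symmetric] abs_minus_commute)
  ultimately show ?thesis
    unfolding hat_def using minmax[of "(x - s) / (p - s)" "(q - x) / (q - p)"
        "(y - s) / (p - s)" "(q - y) / (q - p)"]
    by (simp add: distrib_right)
qed

text \<open>Away from the kinks the hat coincides with an affine function on an open interval, so
  the derivative transfers from there.\<close>

lemma has_real_derivative_hat:
  assumes "t \<notin> {s, p, q}"
  shows "(hat s p q has_real_derivative hat_deriv s p q t) (at t)"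
proof -
  consider "t \<in> {..<s}" | "t \<in> {s<..<p}" | "t \<in> {p<..<q}" | "t \<in> {q<..}"
    using assms by force
  then show ?thesis
  proof cases
    case 1
    have "((\<lambda>t. 0) has_real_derivative hat_deriv s p q t) (at t)"
      using 1 sp pq by (auto simp: hat_deriv_def)
    then show ?thesis
      by (rule has_field_derivative_transform_within_open[OF _ _ 1]) (auto simp: hat_eq_0)
  next
    case 2
    have "((\<lambda>t. (t - s) / (p - s)) has_real_derivative hat_deriv s p q t) (at t)"
      using 2 by (auto simp: hat_deriv_def intro!: derivative_eq_intros)
    then show ?thesis
      by (rule has_field_derivative_transform_within_open[OF _ _ 2]) (auto simp: hat_eq_left)
  next
    case 3
    have "((\<lambda>t. (q - t) / (q - p)) has_real_derivative hat_deriv s p q t) (at t)"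
      using 3 by (auto simp: hat_deriv_def divide_simps intro!: derivative_eq_intros)
    then show ?thesis
      by (rule has_field_derivative_transform_within_open[OF _ _ 3]) (auto simp: hat_eq_right)
  next
    case 4
    have "((\<lambda>t. 0) has_real_derivative hat_deriv s p q t) (at t)"
      using 4 sp pq by (auto simp: hat_deriv_def)
    then show ?thesis
      by (rule has_field_derivative_transform_within_open[OF _ _ 4]) (auto simp: hat_eq_0)
  qed
qed

lemma abs_hat_deriv_le: "\<bar>hat_deriv s p q t\<bar> \<le> 1 / (p - s) + 1 / (q - p)"
  using sp pq by (auto simp: hat_deriv_def)

end

lemma borel_measurable_hat [measurable]: "hat s p q \<in> borel_measurable borel"
  unfolding hat_def[abs_def] by measurable

lemma borel_measurable_hat_deriv [measurable]: "hat_deriv s p q \<in> borel_measurable borel"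
  unfolding hat_deriv_def[abs_def] by measurable

text \<open>Placing the feet of the hat at the neighbouring breakpoints of \<open>p\<close> leaves
  no breakpoint of \<open>S\<close> other than \<open>p\<close> strictly inside its support. The
  kinks then never fall inside a cell, which makes the hat affine on each cell.\<close>

lemma nodal_hat_exists:
  assumes S: "finite S" and p: "p \<in> S"
  obtains s q where "s < p" "p < q"
    "\<And>r. r \<in> S \<Longrightarrow> hat s p q r = (if r = p then 1 else 0)"
    "\<And>c d. consecutive S c d \<Longrightarrow> \<exists>A B. \<forall>t\<in>{c..d}. hat s p q t = A + B * t"
proof -
  \<comment> \<open>At an end of the partition the neighbouring breakpoint is missing; any point beyond it will do.\<close>
  define s where "s = (if \<exists>r\<in>S. r < p then Max {r\<in>S. r < p} else p - 1)"
  define q where "q = (if \<exists>r\<in>S. p < r then Min {r\<in>S. p < r} else p + 1)"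
  have s: "s < p" "\<And>r. r \<in> S \<Longrightarrow> r < p \<Longrightarrow> r \<le> s \<and> s \<in> S"
  proof -
    show "s < p"
    proof (cases "\<exists>r\<in>S. r < p")
      case True
      then have "Max {r\<in>S. r < p} \<in> {r\<in>S. r < p}" using S by (intro Max_in) auto
      with True show ?thesis by (simp add: s_def)
    qed (simp add: s_def)
    show "r \<le> s \<and> s \<in> S" if "r \<in> S" "r < p" for r
      using Max_in[of "{r\<in>S. r < p}"] Max_ge[of "{r\<in>S. r < p}" r] S that
      unfolding s_def by auto
  qed
  have q: "p < q" "\<And>r. r \<in> S \<Longrightarrow> p < r \<Longrightarrow> q \<le> r \<and> q \<in> S"
  proof -
    show "p < q"
    proof (cases "\<exists>r\<in>S. p < r")
      case True
      then have "Min {r\<in>S. p < r} \<in> {r\<in>S. p < r}" using S by (intro Min_in) auto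
      with True show ?thesis by (simp add: q_def)
    qed (simp add: q_def)
    show "q \<le> r \<and> q \<in> S" if "r \<in> S" "p < r" for r
      using Min_in[of "{r\<in>S. p < r}"] Min_le[of "{r\<in>S. p < r}" r] S that
      unfolding q_def by auto
  qed
  have "hat s p q r = (if r = p then 1 else 0)" if "r \<in> S" for r
  proof (cases "r = p")
    case True
    then show ?thesis using s(1) q(1) by (simp add: hat_eq_left)
  next
    case False
    then have "r \<le> s \<or> q \<le> r" using that s q by (meson linorder_neqE)
    then show ?thesis using s(1) q(1) False by (simp add: hat_eq_0)
  qed
  moreover have "\<exists>A B. \<forall>t\<in>{c..d}. hat s p q t = A + B * t" if cd: "consecutive S c d" for c d
  proof -
    have cdS: "c \<in> S" "d \<in> S" "c < d" "\<And>r. r \<in> S \<Longrightarrow> r \<le> c \<or> d \<le> r"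
      using cd by (force simp: consecutive_def)+
    \<comment> \<open>Since \<open>p\<close> is itself a breakpoint, it cannot lie strictly inside
      the cell.\<close>
    consider "d < p" | "d = p" | "c = p" | "p < c"
      using cdS(4)[OF p] cdS(3) by linarith
    then show ?thesis
    proof cases
      case 1
      then have "d \<le> s" using s cdS by blast
      then show ?thesis using s(1) q(1) by (intro exI[of _ 0]) (auto simp: hat_eq_0)
    next
      case 2
      \<comment> \<open>Here the left foot is a true breakpoint, and consecutiveness leaves no room
        for it strictly between \<open>c\<close> and \<open>d = p\<close>.\<close>
      then have "c \<le> s" "s \<in> S" using s cdS by blast+
      then have "c = s" using cdS(4)[of s] s(1) 2 by linarith
      then show ?thesis using s(1) q(1) 2
        by (intro exI[of _ "- s / (p - s)"] exI[of _ "1 / (p - s)"])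
          (auto simp: hat_eq_left diff_divide_distrib)
    next
      case 3
      then have "q \<le> d" "q \<in> S" using q cdS by blast+
      then have "d = q" using cdS(4)[of q] q(1) 3 by linarith
      then show ?thesis using s(1) q(1) 3
        by (intro exI[of _ "q / (q - p)"] exI[of _ "- 1 / (q - p)"])
          (auto simp: hat_eq_right diff_divide_distrib)
    next
      case 4
      then have "q \<le> c" using q cdS by blast
      then show ?thesis using s(1) q(1) by (intro exI[of _ 0]) (auto simp: hat_eq_0)
    qed
  qed
  ultimately show thesis using that s(1) q(1) by blast
qed

subsection \<open>Weak derivatives of Lipschitz functions\<close>

text \<open>Weak derivatives are stated over \<open>lebesgue_on \<Omega>\<close>, while the
  translation argument runs over \<open>lborel\<close>. Vanishing off \<open>\<Omega>\<close>
  removes the restriction, and Borel measurability removes the completion.\<close>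

lemma integral_lebesgue_on_eq_lborel:
  fixes f :: "real ^ 'n \<Rightarrow> real"
  assumes "f \<in> borel_measurable borel" "\<Omega> \<in> sets lebesgue" "\<And>x. x \<notin> \<Omega> \<Longrightarrow> f x = 0"
  shows "integral\<^sup>L (lebesgue_on \<Omega>) f = integral\<^sup>L lborel f"
proof -
  have "integral\<^sup>L (lebesgue_on \<Omega>) f = (LINT x|lebesgue. indicator \<Omega> x *\<^sub>R f x)"
    using assms(2) by (intro integral_restrict_space) simp
  also have "(\<lambda>x. indicator \<Omega> x *\<^sub>R f x) = f"
    using assms(3) by (fastforce simp: indicator_def)
  also have "integral\<^sup>L lebesgue f = integral\<^sup>L lborel f"
    using assms(1) by (intro integral_completion) simp
  finally show ?thesis .
qed

lemma integral_lborel_translation: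
  fixes f :: "'a::euclidean_space \<Rightarrow> real"
  assumes [measurable]: "f \<in> borel_measurable borel"
  shows "(LINT x|lborel. f (c + x)) = integral\<^sup>L lborel f"
proof -
  have "integral\<^sup>L (distr lborel borel ((+) c)) f = (LINT x|lborel. f (c + x))"
    by (intro integral_distr) auto
  then show ?thesis by (simp add: lborel_distr_plus)
qed

text \<open>The complement of the compact support is open and \<open>\<phi>\<close> is zero on it,
  so the partial derivative vanishes there too. On the support, continuity bounds both functions,
  and \<open>M\<close> is the larger bound.\<close>

lemma test_function_partial_bounds:
  fixes \<phi> :: "real ^ 'n \<Rightarrow> real"
  assumes "test_function \<Omega> \<phi>"
  obtains C M where "compact C" "C \<subseteq> \<Omega>" "\<And>x. x \<notin> C \<Longrightarrow> \<phi> x = 0"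
    "\<And>x. \<phi> differentiable (at x)"
    "continuous_on UNIV (\<lambda>x. frechet_derivative \<phi> (at x) (axis i 1))"
    "\<And>x. x \<notin> C \<Longrightarrow> frechet_derivative \<phi> (at x) (axis i 1) = 0"
    "\<And>x. \<bar>frechet_derivative \<phi> (at x) (axis i 1)\<bar> \<le> M"
    "\<And>x. \<bar>\<phi> x\<bar> \<le> M" "0 \<le> M"
proof -
  obtain C where C: "compact C" "C \<subseteq> \<Omega>" "\<And>x. x \<notin> C \<Longrightarrow> \<phi> x = 0"
    and Ck: "\<And>k. Ck k \<phi>"
    using assms unfolding test_function_def by blast
  let ?d = "\<lambda>x. frechet_derivative \<phi> (at x) (axis i 1)"
  have diff: "\<phi> differentiable (at x)" for x using Ck[of "Suc 0"] by simp
  have cont: "continuous_on UNIV ?d" using Ck[of "Suc 0"] by simp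
  have zero: "?d x = 0" if "x \<notin> C" for x
  proof -
    have "((\<lambda>_. 0) has_derivative (\<lambda>_. 0)) (at x)" by simp
    then have "(\<phi> has_derivative (\<lambda>_. 0)) (at x)"
      by (rule has_derivative_transform_within_open[where s = "- C"])
        (use C that compact_imp_closed in auto)
    then show ?thesis by (metis frechet_derivative_at)
  qed
  have "bounded (?d ` C)"
    using C(1) cont by (intro compact_imp_bounded compact_continuous_image)
      (auto intro: continuous_on_subset)
  then obtain M1 where M1: "M1 > 0" "\<And>x. x \<in> C \<Longrightarrow> \<bar>?d x\<bar> \<le> M1"
    by (auto simp: bounded_pos)
  have "bounded (\<phi> ` C)"
    using C(1) Ck[of 0] by (intro compact_imp_bounded compact_continuous_image)
      (auto intro: continuous_on_subset)
  then obtain M2 where M2: "M2 > 0" "\<And>x. x \<in> C \<Longrightarrow> \<bar>\<phi> x\<bar> \<le> M2"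
    by (auto simp: bounded_pos)
  show thesis
  proof (rule that[of C "max M1 M2"])
    show "\<bar>?d x\<bar> \<le> max M1 M2" for x
      using M1 zero[of x] by (cases "x \<in> C") (auto simp: le_max_iff_disj)
    show "\<bar>\<phi> x\<bar> \<le> max M1 M2" for x
      using M1 M2 C(3)[of x] by (cases "x \<in> C") (auto simp: le_max_iff_disj)
  qed (use C diff cont zero M1 in auto)
qed

lemma has_real_derivative_along_axis:
  fixes f :: "real ^ 'n \<Rightarrow> real"
  assumes "f differentiable (at (x + t *\<^sub>R e))"
  shows "((\<lambda>t. f (x + t *\<^sub>R e)) has_real_derivative frechet_derivative f (at (x + t *\<^sub>R e)) e) (at t)"
proof -
  have f: "(f has_derivative frechet_derivative f (at (x + t *\<^sub>R e))) (at (x + t *\<^sub>R e))"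
    using assms frechet_derivative_works by blast
  have "((\<lambda>t. x + t *\<^sub>R e) has_derivative (\<lambda>t. t *\<^sub>R e)) (at t)"
    by (auto intro!: derivative_eq_intros)
  from has_derivative_compose[OF this f]
  have "((\<lambda>t. f (x + t *\<^sub>R e)) has_derivative (\<lambda>s. frechet_derivative f (at (x + t *\<^sub>R e)) (s *\<^sub>R e))) (at t)" .
  moreover have "frechet_derivative f (at (x + t *\<^sub>R e)) (s *\<^sub>R e)
      = frechet_derivative f (at (x + t *\<^sub>R e)) e * s" for s
    using linear_frechet_derivative[OF assms] by (simp add: linear_cmul mult.commute)
  ultimately show ?thesis by (simp add: has_field_derivative_def)
qed

text \<open>Sequential form of the derivative, as dominated convergence needs it; the steps may have
  either sign.\<close>

lemma quotient_tendsto_of_DERIV: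
  fixes f :: "real \<Rightarrow> real"
  assumes "(f has_real_derivative D) (at 0)" and "t \<longlonglongrightarrow> 0" and "\<And>n. t n \<noteq> 0"
  shows "(\<lambda>n. (f (t n) - f 0) / t n) \<longlonglongrightarrow> D"
proof -
  have "((\<lambda>h. (f h - f 0) / h) \<longlongrightarrow> D) (at 0)"
    using assms(1) by (simp add: DERIV_def)
  moreover have "filterlim t (at 0) sequentially"
    using assms(2,3) by (simp add: filterlim_at)
  ultimately show ?thesis by (rule filterlim_compose)
qed

text \<open>The Lipschitz bound in direction \<open>i\<close> dominates the difference quotients of
  \<open>u\<close>, so their convergence almost everywhere suffices and the kinks of the hats do no
  harm. No boundary terms arise because \<open>u\<close> lives on the whole space and test functions
  have compact support in \<open>\<Omega>\<close>.\<close>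

lemma weak_partial_of_AE_derivative:
  fixes u g :: "real ^ 'n \<Rightarrow> real"
  assumes [measurable]: "u \<in> borel_measurable borel" "g \<in> borel_measurable borel"
    and \<Omega>: "\<Omega> \<in> sets lebesgue"
    and B: "\<And>x. \<bar>u x\<bar> \<le> B"
    and L: "\<And>x t. \<bar>u (x + t *\<^sub>R axis i 1) - u x\<bar> \<le> L * \<bar>t\<bar>"
    and deriv: "AE x in lborel. ((\<lambda>t. u (x + t *\<^sub>R axis i 1)) has_real_derivative g x) (at 0)"
  shows "weak_partial \<Omega> i u g"
  unfolding weak_partial_def
proof (intro allI impI)
  fix \<phi> :: "real ^ 'n \<Rightarrow> real" assume \<phi>: "test_function \<Omega> \<phi>"
  define e :: "real ^ 'n" where "e = axis i 1"
  define d where "d = (\<lambda>x. frechet_derivative \<phi> (at x) e)"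
  obtain C M where C: "compact C" "C \<subseteq> \<Omega>" "\<And>x. x \<notin> C \<Longrightarrow> \<phi> x = 0"
    and diff: "\<And>x. \<phi> differentiable (at x)" and cont: "continuous_on UNIV d"
    and d0: "\<And>x. x \<notin> C \<Longrightarrow> d x = 0" and M: "\<And>x. \<bar>d x\<bar> \<le> M" "\<And>x. \<bar>\<phi> x\<bar> \<le> M" "0 \<le> M"
    using test_function_partial_bounds[OF \<phi>, of i] unfolding d_def e_def by metis
  have [measurable]: "\<phi> \<in> borel_measurable borel"
    using diff by (intro borel_measurable_continuous_onI)
      (auto intro!: continuous_at_imp_continuous_on differentiable_imp_continuous_within)
  have [measurable]: "d \<in> borel_measurable borel"
    using cont by (rule borel_measurable_continuous_onI)
  have \<phi>_along: "((\<lambda>t. \<phi> (x + t *\<^sub>R e)) has_real_derivative d (x + t *\<^sub>R e)) (at t)" for x t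
    unfolding d_def by (intro has_real_derivative_along_axis diff)
  have \<phi>_lip: "\<bar>\<phi> (x + t *\<^sub>R e) - \<phi> x\<bar> \<le> M * \<bar>t\<bar>" for x t
    using field_differentiable_bound[of UNIV "\<lambda>t. \<phi> (x + t *\<^sub>R e)" "\<lambda>t. d (x + t *\<^sub>R e)" M t 0]
      \<phi>_along M(1) by auto
  define r :: "nat \<Rightarrow> real" where "r = (\<lambda>n. 1 / real (Suc n))"
  have r: "r n > 0" "r n \<le> 1" for n by (auto simp: r_def)
  have r_lim: "r \<longlonglongrightarrow> 0" unfolding r_def by (rule LIMSEQ_Suc) (rule lim_1_over_n)
  \<comment> \<open>\<open>K\<close> is the closed 1-neighbourhood of \<open>C\<close>. As
    \<open>r n \<le> 1\<close>, it contains the supports of all shifted copies of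
    \<open>\<phi>\<close>, which gives a dominating function independent of
    \<open>n\<close>.\<close>
  define K where "K = {x + y |x y. x \<in> C \<and> y \<in> cball (0 :: real ^ 'n) 1}"
  have K: "compact K" unfolding K_def by (intro compact_sums C) simp
  have [measurable]: "K \<in> sets borel" "C \<in> sets borel"
    using K C by (auto intro: borel_compact)
  have CK: "x \<in> K" if "x + t *\<^sub>R e \<in> C" "\<bar>t\<bar> \<le> 1" for x t
    unfolding K_def using that by (intro CollectI exI[of _ "x + t *\<^sub>R e"] exI[of _ "- t *\<^sub>R e"])
      (simp add: e_def)
  have B0: "0 \<le> B" using B[of 0] by linarith
  have int_compact: "integrable lborel f"
    if [measurable]: "f \<in> borel_measurable borel" and "\<And>x. \<bar>f x\<bar> \<le> c" "\<And>x. x \<notin> K \<Longrightarrow> f x = 0"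
    for f :: "real ^ 'n \<Rightarrow> real" and c
    by (rule integrableI_bounded_set[where A = K and B = c])
      (use that emeasure_compact_finite[OF K] in auto)

  \<comment> \<open>Translation invariance moves the difference quotient from \<open>\<phi>\<close> to \<open>u\<close>; both sides
    converge by dominated convergence, which replaces integration by parts.\<close>
  have lim1: "(\<lambda>n. LINT x|lborel. u x * ((\<phi> (x + r n *\<^sub>R e) - \<phi> x) / r n))
      \<longlonglongrightarrow> (LINT x|lborel. u x * d x)"
  proof (rule integral_dominated_convergence[where w = "\<lambda>x. B * M * indicator K x"])
    show "integrable lborel (\<lambda>x. B * M * indicator K x)"
      by (rule int_compact[of _ "B * M"]) (use B0 M in \<open>auto simp: indicator_def\<close>)
    show "AE x in lborel. (\<lambda>n. u x * ((\<phi> (x + r n *\<^sub>R e) - \<phi> x) / r n)) \<longlonglongrightarrow> u x * d x"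
    proof (intro AE_I2 tendsto_mult tendsto_const)
      fix x
      show "(\<lambda>n. (\<phi> (x + r n *\<^sub>R e) - \<phi> x) / r n) \<longlonglongrightarrow> d x"
        using quotient_tendsto_of_DERIV[of "\<lambda>t. \<phi> (x + t *\<^sub>R e)" "d x" r] \<phi>_along[of x 0] r(1)
          r_lim by (simp add: less_imp_neq[symmetric])
    qed
    show "AE x in lborel. norm (u x * ((\<phi> (x + r n *\<^sub>R e) - \<phi> x) / r n)) \<le> B * M * indicator K x" for n
    proof (intro AE_I2)
      fix x
      show "norm (u x * ((\<phi> (x + r n *\<^sub>R e) - \<phi> x) / r n)) \<le> B * M * indicator K x"
      proof (cases "x \<in> K")
        case True
        have "\<bar>(\<phi> (x + r n *\<^sub>R e) - \<phi> x) / r n\<bar> \<le> M"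
          using \<phi>_lip[of x "r n"] r(1)[of n] by (simp add: divide_simps)
        then have "norm (u x * ((\<phi> (x + r n *\<^sub>R e) - \<phi> x) / r n)) \<le> B * M"
          unfolding real_norm_def abs_mult using B[of x] B0 by (intro mult_mono) auto
        then show ?thesis using True by simp
      next
        case False
        then have "\<phi> (x + r n *\<^sub>R e) = 0" "\<phi> x = 0"
          using CK[of x "r n"] CK[of x 0] C(3) r[of n] by (auto simp: abs_of_pos)
        then show ?thesis using False by simp
      qed
    qed
  qed measurable
  have lim2: "(\<lambda>n. LINT x|lborel. (u (x - r n *\<^sub>R e) - u x) / r n * \<phi> x)
      \<longlonglongrightarrow> (LINT x|lborel. - g x * \<phi> x)"
  proof (rule integral_dominated_convergence[where w = "\<lambda>x. L * M * indicator K x"])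
    have L0: "0 \<le> L" using L[of 0 1] by linarith
    show "integrable lborel (\<lambda>x. L * M * indicator K x)"
      by (rule int_compact[of _ "L * M"]) (use L0 M in \<open>auto simp: indicator_def\<close>)
    show "AE x in lborel. (\<lambda>n. (u (x - r n *\<^sub>R e) - u x) / r n * \<phi> x) \<longlonglongrightarrow> - g x * \<phi> x"
      using deriv
    proof eventually_elim
      case (elim x)
      \<comment> \<open>The backward quotient with negative step \<open>- r n\<close> tends to
        \<open>g x\<close>; dividing by \<open>r n\<close> instead flips the sign, hence
        \<open>- g\<close> in the limit.\<close>
      have "(\<lambda>n. (u (x + (- r n) *\<^sub>R e) - u (x + 0 *\<^sub>R e)) / (- r n)) \<longlonglongrightarrow> g x"
        using elim r(1) tendsto_minus[OF r_lim] unfolding e_def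
        by (intro quotient_tendsto_of_DERIV[of "\<lambda>t. u (x + t *\<^sub>R axis i 1)"])
          (auto simp: less_imp_neq[symmetric])
      from tendsto_minus[OF this] show ?case by (intro tendsto_mult tendsto_const) simp
    qed
    show "AE x in lborel. norm ((u (x - r n *\<^sub>R e) - u x) / r n * \<phi> x) \<le> L * M * indicator K x" for n
    proof (intro AE_I2)
      fix x
      show "norm ((u (x - r n *\<^sub>R e) - u x) / r n * \<phi> x) \<le> L * M * indicator K x"
      proof (cases "x \<in> K")
        case True
        have "\<bar>(u (x - r n *\<^sub>R e) - u x) / r n\<bar> \<le> L"
          using L[of x "- r n"] r(1)[of n] by (simp add: divide_simps e_def)
        then have "norm ((u (x - r n *\<^sub>R e) - u x) / r n * \<phi> x) \<le> L * M"
          unfolding real_norm_def abs_mult using M(2)[of x] L0 by (intro mult_mono) auto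
        then show ?thesis using True by simp
      next
        case False
        then have "\<phi> x = 0" using CK[of x 0] C(3) by auto
        then show ?thesis using False by simp
      qed
    qed
  qed measurable
  have "(LINT x|lborel. u x * ((\<phi> (x + r n *\<^sub>R e) - \<phi> x) / r n))
      = (LINT x|lborel. (u (x - r n *\<^sub>R e) - u x) / r n * \<phi> x)" for n
  proof -
    \<comment> \<open>Splitting the integrals of differences requires each product to be integrable
      on its own; all three are bounded by \<open>B * M\<close> and vanish off
      \<open>K\<close>.\<close>
    have shifted: "integrable lborel (\<lambda>x. u x * \<phi> (x + r n *\<^sub>R e))"
      by (rule int_compact[of _ "B * M"])
        (use CK[of _ "r n"] C(3) r[of n] B M B0 in \<open>auto simp: abs_mult abs_of_pos intro!: mult_mono\<close>)
    have unshifted: "integrable lborel (\<lambda>x. u x * \<phi> x)"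
      by (rule int_compact[of _ "B * M"])
        (use CK[of _ 0] C(3) B M B0 in \<open>auto simp: abs_mult intro!: mult_mono\<close>)
    have shifted': "integrable lborel (\<lambda>x. u (x - r n *\<^sub>R e) * \<phi> x)"
      by (rule int_compact[of _ "B * M"])
        (use CK[of _ 0] C(3) B M B0 in \<open>auto simp: abs_mult intro!: mult_mono\<close>)
    have "(LINT x|lborel. u x * ((\<phi> (x + r n *\<^sub>R e) - \<phi> x) / r n))
        = (LINT x|lborel. (u x * \<phi> (x + r n *\<^sub>R e) - u x * \<phi> x) / r n)"
      by (simp add: algebra_simps)
    also have "\<dots> = ((LINT x|lborel. u x * \<phi> (x + r n *\<^sub>R e)) - (LINT x|lborel. u x * \<phi> x)) / r n"
      using shifted unshifted by simp
    \<comment> \<open>Change of variables by \<open>r n *\<^sub>R e\<close>: the forward shift of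
      \<open>\<phi>\<close> becomes a backward shift of \<open>u\<close>.\<close>
    also have "(LINT x|lborel. u x * \<phi> (x + r n *\<^sub>R e)) = (LINT x|lborel. u (x - r n *\<^sub>R e) * \<phi> x)"
      using integral_lborel_translation[of "\<lambda>x. u (x - r n *\<^sub>R e) * \<phi> x" "r n *\<^sub>R e"]
      by (simp add: add.commute)
    also have "(\<dots> - (LINT x|lborel. u x * \<phi> x)) / r n
        = (LINT x|lborel. (u (x - r n *\<^sub>R e) * \<phi> x - u x * \<phi> x) / r n)"
      using shifted' unshifted by simp
    also have "\<dots> = (LINT x|lborel. (u (x - r n *\<^sub>R e) - u x) / r n * \<phi> x)"
      by (simp add: algebra_simps)
    finally show ?thesis .
  qed
  then have "(LINT x|lborel. u x * d x) = (LINT x|lborel. - g x * \<phi> x)"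
    by (intro LIMSEQ_unique[OF lim1]) (simp only: lim2)
  then have "(LINT x|lborel. u x * d x) = - (LINT x|lborel. g x * \<phi> x)"
    by simp
  \<comment> \<open>Both integrands vanish off \<open>C\<close>, which lies in
    \<open>\<Omega>\<close>, so integrating over \<open>\<Omega>\<close> or over the whole space is
    the same.\<close>
  moreover have "(LINT x|lebesgue_on \<Omega>. u x * d x) = (LINT x|lborel. u x * d x)"
    using \<Omega> C d0 by (intro integral_lebesgue_on_eq_lborel) auto
  moreover have "(LINT x|lebesgue_on \<Omega>. g x * \<phi> x) = (LINT x|lborel. g x * \<phi> x)"
    using \<Omega> C by (intro integral_lebesgue_on_eq_lborel) auto
  ultimately show "(LINT x|lebesgue_on \<Omega>. u x * frechet_derivative \<phi> (at x) (axis i 1))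
       = - (LINT x|lebesgue_on \<Omega>. g x * \<phi> x)"
    by (simp add: d_def e_def)
qed

subsection \<open>Nodal basis functions\<close>

lemma L2_bounded_borel:
  fixes u :: "real ^ 'n \<Rightarrow> real"
  assumes u: "u \<in> borel_measurable borel" and B: "\<And>x. \<bar>u x\<bar> \<le> B"
  shows "u \<in> L2 (box a b)"
proof -
  have m: "u \<in> borel_measurable (lebesgue_on (box a b))"
    using u by (intro measurable_restrict_space1 measurable_completion) simp
  have "integrable (lebesgue_on (box a b)) (\<lambda>x. (u x)\<^sup>2)"
  proof (rule integrableI_bounded_set[where A = "box a b" and B = "B\<^sup>2"])
    show "emeasure (lebesgue_on (box a b)) (box a b) < \<infinity>"
      by (simp add: emeasure_restrict_space emeasure_lborel_box_eq)
    show "AE x in lebesgue_on (box a b). x \<in> box a b \<longrightarrow> norm ((u x)\<^sup>2) \<le> B\<^sup>2"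
      using B by (auto simp: abs_le_square_iff[symmetric] intro: order.trans[OF _ abs_ge_self])
    show "AE x in lebesgue_on (box a b). x \<notin> box a b \<longrightarrow> (u x)\<^sup>2 = 0"
      by (intro AE_I2) auto
  qed (use m in auto)
  with m show ?thesis by (simp add: L2_def)
qed

text \<open>Each excluded value removes a hyperplane, which is a null set. This disposes of the
  kinks in a tensor-product hat.\<close>

lemma AE_component_notin_finite:
  assumes "finite N"
  shows "AE x in lborel. (x :: real ^ 'n) $ i \<notin> N"
proof -
  have "AE x in lborel. (x :: real ^ 'n) $ i \<noteq> c" for c
  proof -
    have "negligible {x :: real ^ 'n. x \<bullet> axis i 1 = c}"
      by (rule negligible_standard_hyperplane) simp
    moreover have "{x :: real ^ 'n. x \<bullet> axis i 1 = c} \<in> sets lborel"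
      by simp
    ultimately have "{x :: real ^ 'n. x \<bullet> axis i 1 = c} \<in> null_sets lborel"
      using null_sets_completion_iff[of _ lborel] negligible_iff_null_sets by blast
    from AE_not_in[OF this] show ?thesis by (simp add: inner_axis)
  qed
  then have "AE x in lborel. \<forall>c\<in>N. (x :: real ^ 'n) $ i \<noteq> c"
    using assms by (intro AE_finite_allI) auto
  then show ?thesis by eventually_elim auto
qed

text \<open>Moving along axis \<open>i\<close> changes only the factor with index \<open>i\<close>;
  the remaining product \<open>R i\<close> stays constant and is at most 1 in absolute value. The
  Lipschitz bound and the derivative thus reduce to the one-dimensional hat. The scalar
  \<open>c\<close> will be a component of a vector coefficient.\<close>

lemma H1_tensor_hat:
  fixes s p q :: "'n::finite \<Rightarrow> real"
  assumes sp: "\<And>j. s j < p j" and pq: "\<And>j. p j < q j"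
  shows "(\<lambda>x :: real ^ 'n. c * (\<Prod>j\<in>UNIV. hat (s j) (p j) (q j) (x $ j))) \<in> H1 (box a b)"
proof -
  define h where "h = (\<lambda>j. hat (s j) (p j) (q j))"
  define h' where "h' = (\<lambda>j. hat_deriv (s j) (p j) (q j))"
  define L where "L = (\<lambda>j. 1 / (p j - s j) + 1 / (q j - p j))"
  define u where "u = (\<lambda>x :: real ^ 'n. c * (\<Prod>j\<in>UNIV. h j (x $ j)))"
  define R where "R = (\<lambda>i (x :: real ^ 'n). \<Prod>j\<in>UNIV - {i}. h j (x $ j))"
  have [measurable]: "h j \<in> borel_measurable borel" "h' j \<in> borel_measurable borel" for j
    by (auto simp: h_def h'_def)
  have h: "0 \<le> h j t" "h j t \<le> 1" for j t
    using sp[of j] pq[of j] by (auto simp: h_def hat_nonneg hat_le_1)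
  have R: "\<bar>R i x\<bar> \<le> 1" for i x
    unfolding R_def abs_prod using h by (intro prod_le_1) auto
  have u_split: "u x = c * h i (x $ i) * R i x" for i x
    by (simp add: u_def R_def prod.remove[of UNIV i])
  have R_shift: "R i (x + t *\<^sub>R axis i 1) = R i x" for i x t
    unfolding R_def by (intro prod.cong) (auto simp: axis_def)
  have u_meas [measurable]: "u \<in> borel_measurable borel"
    unfolding u_def by measurable
  have R_meas [measurable]: "R i \<in> borel_measurable borel" for i
    unfolding R_def by measurable
  have u_bound: "\<bar>u x\<bar> \<le> \<bar>c\<bar>" for x
    unfolding u_def abs_mult abs_prod using h
    by (intro mult_left_le prod_le_1) auto
  have "\<exists>g\<in>L2 (box a b). weak_partial (box a b) i u g" for i
  proof
    \<comment> \<open>The classical partial derivative off the kinks, with all other factors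
      frozen.\<close>
    let ?g = "\<lambda>x. c * h' i (x $ i) * R i x"
    have h'_bound: "\<bar>h' i t\<bar> \<le> L i" for t
      unfolding h'_def L_def by (rule abs_hat_deriv_le[OF sp pq])
    have L0: "0 \<le> L i" using h'_bound[of 0] by linarith
    show "?g \<in> L2 (box a b)"
    proof (rule L2_bounded_borel)
      show "\<bar>?g x\<bar> \<le> \<bar>c\<bar> * L i * 1" for x
        unfolding abs_mult using h'_bound R L0 by (intro mult_mono) auto
    qed measurable
    show "weak_partial (box a b) i u ?g"
    proof (rule weak_partial_of_AE_derivative[where L = "\<bar>c\<bar> * L i" and B = "\<bar>c\<bar>"])
      show "\<bar>u (x + t *\<^sub>R axis i 1) - u x\<bar> \<le> \<bar>c\<bar> * L i * \<bar>t\<bar>" for x t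
      proof -
        have "\<bar>h i (x $ i + t) - h i (x $ i)\<bar> \<le> L i * \<bar>t\<bar>"
          using hat_lipschitz[OF sp pq, of i "x $ i + t" "x $ i"] by (simp add: h_def L_def)
        then have "\<bar>c\<bar> * \<bar>h i (x $ i + t) - h i (x $ i)\<bar> * \<bar>R i x\<bar> \<le> \<bar>c\<bar> * (L i * \<bar>t\<bar>) * 1"
          using R L0 by (intro mult_mono) auto
        moreover have "u (x + t *\<^sub>R axis i 1) - u x = c * (h i (x $ i + t) - h i (x $ i)) * R i x"
          unfolding u_split[of _ i] R_shift by (simp add: algebra_simps)
        ultimately show ?thesis by (simp add: abs_mult mult.assoc)
      qed
      have "AE x in lborel. (x :: real ^ 'n) $ i \<notin> {s i, p i, q i}"
        by (rule AE_component_notin_finite) simp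
      then show "AE x in lborel. ((\<lambda>t. u (x + t *\<^sub>R axis i 1)) has_real_derivative ?g x) (at 0)"
      proof eventually_elim
        case (elim x)
        have "(h i has_real_derivative h' i (x $ i)) (at (x $ i))"
          unfolding h_def h'_def by (rule has_real_derivative_hat[OF sp pq elim])
        then have "((\<lambda>t. h i (x $ i + t)) has_real_derivative h' i (x $ i)) (at 0)"
          using DERIV_shift[of "h i" "h' i (x $ i)" 0 "x $ i"] by (simp add: add.commute)
        then have "((\<lambda>t. c * h i (x $ i + t) * R i x) has_real_derivative ?g x) (at 0)"
          by (auto intro!: derivative_eq_intros)
        then show ?case by (simp add: u_split[of _ i] R_shift)
      qed
    qed (use u_bound in \<open>auto intro: u_meas\<close>)
  qed
  moreover have "u \<in> L2 (box a b)" using u_bound by (rule L2_bounded_borel[rotated]) simp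
  ultimately show ?thesis by (simp add: H1_def u_def h_def)
qed

text \<open>Expanding the product, \<open>S\<close> collects the factors that contribute their
  linear term and its complement those that contribute their constant; each choice gives one
  monomial.\<close>

lemma Q1_prod_affine: "(\<lambda>x :: real ^ 'n. c * (\<Prod>j\<in>UNIV. A j + B j * x $ j)) \<in> Q1"
proof -
  have "c * (\<Prod>j\<in>UNIV. A j + B j * x $ j)
      = (\<Sum>S\<in>UNIV. (c * (\<Prod>j\<in>S. B j) * (\<Prod>j\<in>UNIV - S. A j)) * (\<Prod>j\<in>S. x $ j))" for x :: "real ^ 'n"
    using prod_add[of UNIV "\<lambda>j. B j * x $ j" A]
    by (simp add: add.commute sum_distrib_left prod.distrib mult_ac)
  then show ?thesis
    unfolding Q1_def
    by (intro CollectI exI[of _ "\<lambda>S. c * (\<Prod>j\<in>S. B j) * (\<Prod>j\<in>UNIV - S. A j)"]) blast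
qed

text \<open>All corners lie in a product of finite sets. Finiteness matters because a sum over an
  infinite set is 0 by convention, which would destroy the positivity of the nodal weight.\<close>

lemma finite_cells:
  assumes "\<And>i. finite (P i)"
  shows "finite (cells P :: ((real ^ 'n) \<times> (real ^ 'n)) set)"
proof -
  have "finite (vec_lambda ` (PiE UNIV P) :: (real ^ 'n) set)"
    using assms by (intro finite_imageI finite_PiE) auto
  moreover have "{x :: real ^ 'n. \<forall>i. x $ i \<in> P i} \<subseteq> vec_lambda ` (PiE UNIV P)"
    by (force intro: image_eqI[where x = "\<lambda>i. _ $ i"] simp: vec_nth_inverse)
  ultimately have "finite {x :: real ^ 'n. \<forall>i. x $ i \<in> P i}"
    by (rule finite_subset[rotated])
  then have "finite ({x :: real ^ 'n. \<forall>i. x $ i \<in> P i} \<times> {x :: real ^ 'n. \<forall>i. x $ i \<in> P i})"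
    by blast
  then show ?thesis by (rule finite_subset[rotated]) (auto simp: cells_def consecutive_def)
qed

lemma node_component_mem: "z \<in> nodes P \<Longrightarrow> z $ i \<in> P i"
proof -
  assume "z \<in> nodes P"
  then obtain l u where "(l, u) \<in> cells P" "z \<in> vertices l u"
    by (auto simp: nodes_def)
  then have "l $ i \<in> P i" "u $ i \<in> P i" "z $ i = l $ i \<or> z $ i = u $ i"
    by (auto simp: cells_def vertices_def consecutive_def)
  then show ?thesis by metis
qed

text \<open>The basis function is the product of one-dimensional nodal hats centred at the
  coordinates of \<open>z\<close>. A different node differs in some coordinate, and the
  corresponding factor vanishes there.\<close>

lemma nodal_basis_exists:
  fixes P :: "'n::finite \<Rightarrow> real set"
  assumes fin: "\<And>i. finite (P i)" and z: "z \<in> nodes P"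
  obtains \<phi> :: "real ^ 'n \<Rightarrow> real"
  where "\<And>c. (\<lambda>x. \<phi> x *\<^sub>R c) \<in> S1 (box a b) P"
    "\<And>y. y \<in> nodes P \<Longrightarrow> \<phi> y = (if y = z then 1 else 0)"
proof -
  have "\<exists>s q. s < z $ j \<and> z $ j < q \<and>
      (\<forall>r\<in>P j. hat s (z $ j) q r = (if r = z $ j then 1 else 0)) \<and>
      (\<forall>c d. consecutive (P j) c d \<longrightarrow> (\<exists>A B. \<forall>t\<in>{c..d}. hat s (z $ j) q t = A + B * t))" for j
    by (rule nodal_hat_exists[OF fin node_component_mem[OF z], of j]) blast
  then obtain s q where sq: "\<And>j. s j < z $ j" "\<And>j. z $ j < q j"
    and nodal: "\<And>j r. r \<in> P j \<Longrightarrow> hat (s j) (z $ j) (q j) r = (if r = z $ j then 1 else 0)"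
    and affine: "\<And>j c d. consecutive (P j) c d
      \<Longrightarrow> \<exists>A B. \<forall>t\<in>{c..d}. hat (s j) (z $ j) (q j) t = A + B * t"
    by metis
  define \<phi> where "\<phi> = (\<lambda>x :: real ^ 'n. \<Prod>j\<in>UNIV. hat (s j) (z $ j) (q j) (x $ j))"
  show thesis
  proof
    show "(\<lambda>x. \<phi> x *\<^sub>R c) \<in> S1 (box a b) P" for c
      unfolding S1_def
    proof (intro CollectI allI conjI ballI)
      fix k
      show "(\<lambda>x. (\<phi> x *\<^sub>R c) $ k) \<in> H1 (box a b)"
        using H1_tensor_hat[of s "\<lambda>j. z $ j" q "c $ k" a b] sq by (simp add: \<phi>_def mult.commute)
      fix K assume K: "K \<in> cells P"
      obtain l u where lu: "K = (l, u)" by (cases K)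
      \<comment> \<open>The edges of a cell join consecutive breakpoints, so every factor is affine
        on it; the coefficients are then chosen for all directions at once.\<close>
      have "\<exists>A B. \<forall>t\<in>{l $ j..u $ j}. hat (s j) (z $ j) (q j) t = A + B * t" for j
        using K by (intro affine) (simp add: cells_def lu)
      then obtain A B where AB:
        "\<And>j t. t \<in> {l $ j..u $ j} \<Longrightarrow> hat (s j) (z $ j) (q j) t = A j + B j * t"
        by metis
      have "\<forall>x\<in>cbox l u. (\<phi> x *\<^sub>R c) $ k = c $ k * (\<Prod>j\<in>UNIV. A j + B j * x $ j)"
        by (simp add: \<phi>_def mem_box_cart AB)
      then show "case K of (l, u) \<Rightarrow> \<exists>p\<in>Q1. \<forall>x\<in>cbox l u. (\<phi> x *\<^sub>R c) $ k = p x"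
        unfolding lu prod.case using Q1_prod_affine[of "c $ k" A B] by (rule bexI)
    qed
    show "\<phi> y = (if y = z then 1 else 0)" if y: "y \<in> nodes P" for y
    proof (cases "y = z")
      case True
      then show ?thesis using nodal[OF node_component_mem[OF y]] by (simp add: \<phi>_def)
    next
      case False
      then obtain j where "y $ j \<noteq> z $ j" by (auto simp: vec_eq_iff)
      then have "hat (s j) (z $ j) (q j) (y $ j) = 0"
        using nodal[OF node_component_mem[OF y]] by simp
      then have "\<phi> y = 0" by (auto simp: \<phi>_def)
      with False show ?thesis by simp
    qed
  qed
qed

subsection \<open>The nodal inner product\<close>

lemma weight_pos:
  assumes "(l, u) \<in> cells P"
  shows "weight l u > 0"
proof -
  have lt: "l $ i < u $ i" for i using assms by (simp add: cells_def consecutive_def)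
  then have "cbox l u \<noteq> {}" by (simp add: interval_ne_empty_cart less_imp_le)
  then have "measure lebesgue (cbox l u) = (\<Prod>i\<in>UNIV. u $ i - l $ i)"
    by (simp add: content_cbox_cart)
  also have "\<dots> > 0" using lt by (intro prod_pos) simp
  finally show ?thesis by (simp add: weight_def)
qed

lemma finite_vertices: "finite (vertices l u :: (real ^ 'n) set)"
proof -
  have "finite (vec_lambda ` (PiE UNIV (\<lambda>i. {l $ i, u $ i})) :: (real ^ 'n) set)"
    by (intro finite_imageI finite_PiE) auto
  moreover have "(vertices l u :: (real ^ 'n) set) \<subseteq> vec_lambda ` (PiE UNIV (\<lambda>i. {l $ i, u $ i}))"
    by (force intro: image_eqI[where x = "\<lambda>i. _ $ i"] simp: vertices_def)
  ultimately show ?thesis by (rule finite_subset[rotated])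
qed

text \<open>\<open>\<beta>\<close> is the lumped mass at \<open>z\<close>: the total weight of the
  cells that have \<open>z\<close> as a vertex, positive because at least one such cell exists. It
  is fixed before \<open>d\<close>, and \<open>d\<close> is arbitrary, so the formula also covers
  cross products, which need not be piecewise multilinear.\<close>

lemma ip_h_nodal:
  fixes P :: "'n::finite \<Rightarrow> real set"
  assumes fin: "\<And>i. finite (P i)" and z: "z \<in> nodes P"
  obtains \<beta> where "\<beta> > 0"
    "\<And>d v c. (\<And>y. y \<in> nodes P \<Longrightarrow> v y = (if y = z then c else 0)) \<Longrightarrow> ip_h P d v = \<beta> * (d z \<bullet> c)"
proof -
  define \<beta> where "\<beta> = (\<Sum>(l, u)\<in>cells P. \<Sum>y\<in>vertices l u. weight l u * (if y = z then 1 else 0))"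
  \<comment> \<open>Within a cell \<open>z\<close> occurs at most once as a vertex, so the inner sum
    collapses to one weight or to 0.\<close>
  have inner: "(\<Sum>y\<in>vertices l u. weight l u * (if y = z then 1 else 0)) =
      (if z \<in> vertices l u then weight l u else 0)" for l u
    using finite_vertices[of l u] by (simp add: if_distrib[of "\<lambda>x. _ * x"] cong: if_cong)
  obtain l u where lu: "(l, u) \<in> cells P" "z \<in> vertices l u"
    using z by (auto simp: nodes_def)
  have "\<beta> > 0"
    unfolding \<beta>_def inner
  proof (rule sum_pos2[OF finite_cells[OF fin] lu(1)])
    show "0 < (case (l, u) of (l, u) \<Rightarrow> if z \<in> vertices l u then weight l u else 0)"
      using lu weight_pos by simp
    show "0 \<le> (case K of (l, u) \<Rightarrow> if z \<in> vertices l u then weight l u else 0)"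
      if "K \<in> cells P" for K
      using that weight_pos by (cases K) (auto intro: less_imp_le)
  qed
  moreover have "ip_h P d v = \<beta> * (d z \<bullet> c)"
    if v: "\<And>y. y \<in> nodes P \<Longrightarrow> v y = (if y = z then c else 0)" for d v c
  proof -
    have "weight l u * (d y \<bullet> v y) = weight l u * (if y = z then 1 else 0) * (d z \<bullet> c)"
      if "(l, u) \<in> cells P" "y \<in> vertices l u" for l u y
    proof -
      have "y \<in> nodes P" using that by (auto simp: nodes_def)
      from v[OF this] show ?thesis by simp
    qed
    then show ?thesis
      unfolding ip_h_def \<beta>_def sum_distrib_right
      by (intro sum.cong refl) (auto simp: sum_distrib_right intro!: sum.cong)
  qed
  ultimately show thesis using that by blast
qed

section \<open>Norm growth under an orthogonal update, and the theorem\<close>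

lemma norm_le_norm_of_orthogonal:
  fixes x y :: "'a::real_inner"
  assumes "(y - x) \<bullet> x = 0"
  shows "norm x \<le> norm y"
proof -
  have "(norm y)\<^sup>2 = (norm x)\<^sup>2 + (norm (y - x))\<^sup>2"
    using norm_add_Pythagorean[of "y - x" x] assms by (simp add: orthogonal_def)
  then show ?thesis by (simp add: power2_le_imp_le)
qed

theorem mainTheorem5:
  fixes a b :: "real ^ 'n"
    and \<Omega> :: "(real ^ 'n) set"
    and F :: "('n \<Rightarrow> real set) set"
    and P :: "'n \<Rightarrow> real set"
    and \<tau> :: real
    and m mt :: "real ^ 'n \<Rightarrow> real ^ 3"
  assumes "CARD('n) \<in> {1, 2, 3}"
    and "\<forall>i. a $ i < b $ i" and "\<Omega> = box a b"
    and "\<forall>M\<in>F. tensor_mesh a b M" and "shape_regular F" and "quasi_uniform F"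
    and "P \<in> F"
    and "\<tau> > 0"
    and "m \<in> S1 \<Omega> P" and "\<forall>z\<in>nodes P. norm (m z) = 1"
    and "mt \<in> S1 \<Omega> P"
    and "\<forall>v\<in>S1 \<Omega> P.
      ip_h P (\<lambda>z. (mt z - m z) /\<^sub>R \<tau>) v
        = - ip_h P (\<lambda>z. cross3 (m z) (cross3 (m z) (disc_laplacian \<Omega> P mt z))) v"
  shows "\<forall>z\<in>nodes P.
    ((mt z - m z) /\<^sub>R \<tau>) \<bullet> m z = 0 \<and> norm (mt z) \<ge> norm (m z) \<and> norm (m z) = 1"
proof
  fix z assume z: "z \<in> nodes P"
  have fin: "finite (P i)" for i
    using assms(4,7) by (auto simp: tensor_mesh_def)
  obtain \<phi> :: "real ^ 'n \<Rightarrow> real"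
    where \<phi>: "\<And>c. (\<lambda>x. \<phi> x *\<^sub>R c) \<in> S1 (box a b) P"
      "\<And>y. y \<in> nodes P \<Longrightarrow> \<phi> y = (if y = z then 1 else 0)"
    using nodal_basis_exists[OF fin z] by blast
  obtain \<beta> where \<beta>: "\<beta> > 0" and ip: "\<And>d v c. (\<And>y. y \<in> nodes P \<Longrightarrow> v y = (if y = z then c else 0))
      \<Longrightarrow> ip_h P d v = \<beta> * (d z \<bullet> c)"
    using ip_h_nodal[OF fin z] by blast
  define v where "v = (\<lambda>x. \<phi> x *\<^sub>R m z)"
  have v: "v y = (if y = z then m z else 0)" if "y \<in> nodes P" for y
    using \<phi>(2)[OF that] by (simp add: v_def)
  have ip_v: "ip_h P d v = \<beta> * (d z \<bullet> m z)" for d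
    by (rule ip) (rule v)
  \<comment> \<open>\<open>ip_v\<close> evaluates the integrand at the fixed node, where the outer
    cross product is orthogonal to its first factor \<open>m z\<close> whatever the second factor
    is.\<close>
  have "ip_h P (\<lambda>z. cross3 (m z) (cross3 (m z) (disc_laplacian \<Omega> P mt z))) v = 0"
    by (simp only: ip_v) (simp add: dot_cross_self)
  moreover have "v \<in> S1 \<Omega> P"
    using \<phi>(1) by (simp add: v_def assms(3))
  ultimately have "ip_h P (\<lambda>z. (mt z - m z) /\<^sub>R \<tau>) v = 0"
    using assms(12) by simp
  then have orth: "((mt z - m z) /\<^sub>R \<tau>) \<bullet> m z = 0"
    using \<beta> by (simp only: ip_v) simp
  \<comment> \<open>As \<open>\<tau> > 0\<close>, the scaling by its inverse drops out, leaving the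
    increment \<open>mt z - m z\<close> orthogonal to \<open>m z\<close>.\<close>
  then have "norm (m z) \<le> norm (mt z)"
    using assms(8) by (intro norm_le_norm_of_orthogonal) auto
  with orth show "((mt z - m z) /\<^sub>R \<tau>) \<bullet> m z = 0 \<and> norm (mt z) \<ge> norm (m z) \<and> norm (m z) = 1"
    using assms(10) z by blast
qed

end
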